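(* For each integer $n\geq 1$: (1) $R_{2n+1}$ is divisible by $\gcd\big(n!\,(n-1)!\,R_n,\ (n+1)!\big)$; (2) $R_{2n}$ is divisible by $n!$.
   Context: A Latin square of order $n$ is an $n\times n$ array with entries from $\{1,\dots,n\}$ in which each row and each column contains each symbol exactly once. It is reduced if its first row is $(1,2,\dots,n)$ and its first column is $(1,2,\dots,n)^T$. $R_n$ denotes the number of reduced Latin squares of order $n$. *)

theory Defs
  imports Complex_Main "HOL-Library.FuncSet"
begin

text \<open>
  Arrays are extensional functions (\<open>undefined\<close> off the index range), so that distinct
  functions are distinct arrays and \<open>card\<close> counts arrays.
\<close>

definition latin_square :: "nat \<Rightarrow> (nat \<Rightarrow> nat \<Rightarrow> nat) \<Rightarrow> bool" where
  "latin_square n L \<longleftrightarrow>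
     L \<in> {1..n} \<rightarrow>\<^sub>E ({1..n} \<rightarrow>\<^sub>E {1..n}) \<and>
     (\<forall>i\<in>{1..n}. \<forall>s\<in>{1..n}. \<exists>!j. j \<in> {1..n} \<and> L i j = s) \<and>
     (\<forall>j\<in>{1..n}. \<forall>s\<in>{1..n}. \<exists>!i. i \<in> {1..n} \<and> L i j = s)"

definition reduced_latin_square :: "nat \<Rightarrow> (nat \<Rightarrow> nat \<Rightarrow> nat) \<Rightarrow> bool" where
  "reduced_latin_square n L \<longleftrightarrow>
     latin_square n L \<and> (\<forall>j\<in>{1..n}. L 1 j = j) \<and> (\<forall>i\<in>{1..n}. L i 1 = i)"

definition num_reduced :: "nat \<Rightarrow> nat" where
  "num_reduced n = card {L. reduced_latin_square n L}"

lemma finite_latin_squares: "finite {L. latin_square n L}"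
proof (rule finite_subset)
  show "{L. latin_square n L} \<subseteq> {1..n} \<rightarrow>\<^sub>E ({1..n} \<rightarrow>\<^sub>E {1..n})"
    by (rule subsetI) (simp only: mem_Collect_eq latin_square_def)
qed (simp add: finite_PiE)

lemma finite_reduced_latin_squares: "finite {L. reduced_latin_square n L}"
  by (rule finite_subset[OF _ finite_latin_squares[of n]])
     (simp add: Collect_mono_iff reduced_latin_square_def)

end

theory Submission
  imports Defs "HOL-Combinatorics.Permutations"
begin

text \<open>
  Reduced Latin squares of order \<open>N\<close> are loops on \<open>{1..N}\<close> with identity \<open>1\<close>. Let \<open>N\<close> be \<open>2 * n\<close>
  or \<open>2 * n + 1\<close>, and let the permutations of \<open>{n+1..N}\<close> act by loop isomorphism. The fixed points
  of an automorphism form a subloop, and a proper subloop has at most \<open>N div 2 = n\<close> elements. So the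
  action is free on the squares in which \<open>{1..n}\<close> is not a subsquare, and their number is divisible
  by \<open>(N - n)!\<close>. If \<open>{1..n}\<close> is a subsquare, then independently of each other the subsquare can be
  replaced by any reduced square of order \<open>n\<close>, the rows \<open>2..n\<close> of the upper right block can be
  permuted, and so can the symbols \<open>1..n\<close> in the lower right block. Hence the number of these
  squares is divisible by \<open>n! (n - 1)! R\<^sub>n\<close>.
\<close>

section \<open>Orbit counting\<close>

text \<open>
  The identity and the inverse may depend on the point \<open>x\<close>, so that \<open>act\<close> need not come from a
  group: replacing the subsquare is covered as well.
\<close>

lemma card_dvd_card_if_free_action:
  fixes act :: "'g \<Rightarrow> 'a \<Rightarrow> 'a"
  assumes "finite S"
    and closed: "\<And>g x. g \<in> G \<Longrightarrow> x \<in> S \<Longrightarrow> act g x \<in> S"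
    and ident: "\<And>x. x \<in> S \<Longrightarrow> \<exists>g\<in>G. act g x = x"
    and inver: "\<And>g x. g \<in> G \<Longrightarrow> x \<in> S \<Longrightarrow> \<exists>h\<in>G. act h (act g x) = x"
    and compo: "\<And>g h x. g \<in> G \<Longrightarrow> h \<in> G \<Longrightarrow> x \<in> S \<Longrightarrow> \<exists>k\<in>G. act g (act h x) = act k x"
    and free: "\<And>x. x \<in> S \<Longrightarrow> inj_on (\<lambda>g. act g x) G"
  shows "card G dvd card S"
proof -
  define r where "r = {(x, y). x \<in> S \<and> (\<exists>g\<in>G. y = act g x)}"
  have "equiv S r"
  proof (rule equivI)
    show "r \<subseteq> S \<times> S" using closed by (auto simp: r_def)
    show "refl_on S r" using ident by (force simp: r_def refl_on_def)
    show "sym r" using inver closed by (force simp: r_def sym_def)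
    show "trans r" using compo by (force simp: r_def trans_def)
  qed
  \<comment> \<open>The classes of \<open>r\<close> are the orbits. By freeness \<open>G\<close> is
    mapped injectively onto the orbit of \<open>x\<close>, so every class has exactly
    \<open>card G\<close> elements.\<close>
  moreover have "card G dvd card X" if "X \<in> S // r" for X
  proof -
    from that obtain x where x: "x \<in> S" "X = r `` {x}" by (auto elim: quotientE)
    then have "X = (\<lambda>g. act g x) ` G" by (auto simp: r_def)
    then show ?thesis using card_image[OF free[OF x(1)]] by simp
  qed
  ultimately show ?thesis using equiv_imp_dvd_card[OF \<open>finite S\<close>] by blast
qed

section \<open>Latin squares as arrays with bijective rows and columns\<close>

text \<open>Every new square below is built through this restriction, which makes it extensional.
  Conversely, \<open>array n L = L\<close> serves as the equational form of extensionality.\<close>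

definition array :: "nat \<Rightarrow> (nat \<Rightarrow> nat \<Rightarrow> nat) \<Rightarrow> nat \<Rightarrow> nat \<Rightarrow> nat" where
  "array n f = (\<lambda>i\<in>{1..n}. \<lambda>j\<in>{1..n}. f i j)"

lemma array_apply [simp]: "i \<in> {1..n} \<Longrightarrow> j \<in> {1..n} \<Longrightarrow> array n f i j = f i j"
  by (simp add: array_def)

lemma array_cong:
  "(\<And>i j. i \<in> {1..n} \<Longrightarrow> j \<in> {1..n} \<Longrightarrow> f i j = g i j) \<Longrightarrow> array n f = array n g"
  unfolding array_def by (intro restrict_ext) auto

lemma bij_betw_iff_ex1:
  assumes "f ` A \<subseteq> B"
  shows "bij_betw f A B \<longleftrightarrow> (\<forall>y\<in>B. \<exists>!x. x \<in> A \<and> f x = y)"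
proof
  assume "bij_betw f A B"
  then show "\<forall>y\<in>B. \<exists>!x. x \<in> A \<and> f x = y"
    unfolding bij_betw_def inj_on_def by (metis imageE)
next
  assume *: "\<forall>y\<in>B. \<exists>!x. x \<in> A \<and> f x = y"
  then have "inj_on f A" using assms by (metis image_subset_iff inj_onI)
  moreover have "B \<subseteq> f ` A" using * by blast
  ultimately show "bij_betw f A B" using assms by (simp add: bij_betw_def subset_antisym)
qed

text \<open>With bijections in place of unique existence, a row or column can be composed with
  permutations, split along a subset and glued from blocks.\<close>

lemma latin_square_iff_bij_betw:
  "latin_square n L \<longleftrightarrow> array n L = L \<and>
     (\<forall>i\<in>{1..n}. bij_betw (L i) {1..n} {1..n}) \<and>
     (\<forall>j\<in>{1..n}. bij_betw (\<lambda>i. L i j) {1..n} {1..n})"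
proof -
  have mem: "L \<in> {1..n} \<rightarrow>\<^sub>E ({1..n} \<rightarrow>\<^sub>E {1..n}) \<longleftrightarrow>
      array n L = L \<and> (\<forall>i\<in>{1..n}. L i ` {1..n} \<subseteq> {1..n})"
  proof (intro iffI conjI ballI)
    assume L: "L \<in> {1..n} \<rightarrow>\<^sub>E ({1..n} \<rightarrow>\<^sub>E {1..n})"
    have "L i = undefined" if "i \<notin> {1..n}" for i using PiE_arb[OF L that] .
    moreover have "L i j = undefined" if "i \<in> {1..n}" "j \<notin> {1..n}" for i j
      using PiE_arb[OF PiE_mem[OF L that(1)] that(2)] .
    ultimately show "array n L = L"
      by (intro ext) (auto simp: array_def restrict_def)
    show "L i ` {1..n} \<subseteq> {1..n}" if "i \<in> {1..n}" for i
      using PiE_mem[OF L that] by blast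
  next
    assume *: "array n L = L \<and> (\<forall>i\<in>{1..n}. L i ` {1..n} \<subseteq> {1..n})"
    have "array n L \<in> {1..n} \<rightarrow>\<^sub>E ({1..n} \<rightarrow>\<^sub>E {1..n})"
      unfolding array_def using * by (intro restrict_PiE_iff[THEN iffD2] ballI) blast
    with * show "L \<in> {1..n} \<rightarrow>\<^sub>E ({1..n} \<rightarrow>\<^sub>E {1..n})" by simp
  qed
  have lines: "(\<forall>i\<in>{1..n}. bij_betw (L i) {1..n} {1..n}) \<and>
      (\<forall>j\<in>{1..n}. bij_betw (\<lambda>i. L i j) {1..n} {1..n}) \<longleftrightarrow>
    (\<forall>i\<in>{1..n}. \<forall>s\<in>{1..n}. \<exists>!j. j \<in> {1..n} \<and> L i j = s) \<and>
      (\<forall>j\<in>{1..n}. \<forall>s\<in>{1..n}. \<exists>!i. i \<in> {1..n} \<and> L i j = s)"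
    if "\<forall>i\<in>{1..n}. L i ` {1..n} \<subseteq> {1..n}"
    using that by (intro conj_cong ball_cong refl bij_betw_iff_ex1) blast+
  show ?thesis
  proof (cases "\<forall>i\<in>{1..n}. L i ` {1..n} \<subseteq> {1..n}")
    case True
    then show ?thesis unfolding latin_square_def mem lines[OF True] by simp
  next
    \<comment> \<open>An entry outside the range refutes both sides: the row containing it is not a
      bijection onto \<open>{1..n}\<close>.\<close>
    case False
    then have "\<not> (\<forall>i\<in>{1..n}. bij_betw (L i) {1..n} {1..n})"
      by (metis bij_betw_imp_surj_on order_refl)
    with False show ?thesis unfolding latin_square_def mem by blast
  qed
qed

lemma array_array [simp]: "array n (array n f) = array n f"
  by (rule array_cong) simp

lemma latin_square_array_iff:
  "latin_square n (array n f) \<longleftrightarrow>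
     (\<forall>i\<in>{1..n}. bij_betw (f i) {1..n} {1..n}) \<and>
     (\<forall>j\<in>{1..n}. bij_betw (\<lambda>i. f i j) {1..n} {1..n})"
proof -
  have "bij_betw (array n f i) {1..n} {1..n} \<longleftrightarrow> bij_betw (f i) {1..n} {1..n}"
    and "bij_betw (\<lambda>k. array n f k i) {1..n} {1..n} \<longleftrightarrow> bij_betw (\<lambda>k. f k i) {1..n} {1..n}"
    if "i \<in> {1..n}" for i
    using that by (intro bij_betw_cong; simp)+
  then show ?thesis by (simp add: latin_square_iff_bij_betw)
qed

lemma latin_squareD:
  assumes "latin_square n L"
  shows latin_square_array: "array n L = L"
    and latin_square_row: "i \<in> {1..n} \<Longrightarrow> bij_betw (L i) {1..n} {1..n}"
    and latin_square_col: "j \<in> {1..n} \<Longrightarrow> bij_betw (\<lambda>i. L i j) {1..n} {1..n}"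
    and latin_square_range: "i \<in> {1..n} \<Longrightarrow> j \<in> {1..n} \<Longrightarrow> L i j \<in> {1..n}"
  using assms unfolding latin_square_iff_bij_betw by (blast dest: bij_betwE)+

text \<open>Closure of the corner is all that is demanded. For \<open>n \<le> N\<close> it already
  makes the corner a reduced Latin square, by injectivity and finiteness.\<close>

definition squares_with_subsquare :: "nat \<Rightarrow> nat \<Rightarrow> (nat \<Rightarrow> nat \<Rightarrow> nat) set" where
  "squares_with_subsquare N n =
     {L. reduced_latin_square N L \<and> (\<forall>i\<in>{1..n}. \<forall>j\<in>{1..n}. L i j \<in> {1..n})}"

subsection \<open>Squares without a subsquare\<close>

text \<open>For \<open>k\<close> outside \<open>F\<close>, row \<open>k\<close> maps
  \<open>F\<close> injectively into the complement of \<open>F\<close>, so \<open>{1..N}\<close>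
  contains two disjoint sets of size \<open>card F\<close>.\<close>

lemma subsquare_card_le_half:
  assumes L: "latin_square N L" and F: "F \<subset> {1..N}"
    and closed: "\<And>i j. i \<in> F \<Longrightarrow> j \<in> F \<Longrightarrow> L i j \<in> F"
  shows "2 * card F \<le> N"
proof -
  from F obtain k where k: "k \<in> {1..N}" "k \<notin> F" by blast
  have finF: "finite F" using F finite_subset by blast
  have inj: "inj_on (L k) F"
    using latin_square_row[OF L k(1)] F by (meson bij_betw_def inj_on_subset psubset_imp_subset)
  have "L k x \<notin> F" if x: "x \<in> F" for x
  proof
    assume "L k x \<in> F"
    have col: "inj_on (\<lambda>i. L i x) {1..N}"
      using latin_square_col[OF L, of x] x F by (auto simp: bij_betw_def)
    \<comment> \<open>Column \<open>x\<close> is an injective self-map of the finite set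
      \<open>F\<close>, hence onto. A value \<open>L k x\<close> in \<open>F\<close> would therefore
      occur a second time in this column, in a row from \<open>F\<close>.\<close>
    then have "inj_on (\<lambda>i. L i x) F" using F inj_on_subset by blast
    then have "(\<lambda>i. L i x) ` F = F"
      using closed x finF by (intro endo_inj_surj) auto
    with \<open>L k x \<in> F\<close> obtain k' where "k' \<in> F" "L k' x = L k x" by (metis imageE)
    then have "k' = k" using col k F by (meson inj_onD psubsetD)
    then show False using \<open>k' \<in> F\<close> k by simp
  qed
  then have "card (F \<union> L k ` F) = 2 * card F"
    using finF card_image[OF inj] by (subst card_Un_disjoint) auto
  moreover have "F \<union> L k ` F \<subseteq> {1..N}"
    using F latin_square_range[OF L k(1)] by blast
  ultimately show ?thesis using card_mono[of "{1..N}" "F \<union> L k ` F"] by simp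
qed

section \<open>The action by loop isomorphism\<close>

text \<open>Transport of structure: the new product of \<open>p x\<close> and \<open>p y\<close> is
  \<open>p (L x y)\<close>.\<close>

definition isomorph :: "nat \<Rightarrow> (nat \<Rightarrow> nat) \<Rightarrow> (nat \<Rightarrow> nat \<Rightarrow> nat) \<Rightarrow> nat \<Rightarrow> nat \<Rightarrow> nat" where
  "isomorph N p L = array N (\<lambda>i j. p (L (inv p i) (inv p j)))"

lemma isomorph_id: "latin_square N L \<Longrightarrow> isomorph N id L = L"
  by (simp add: isomorph_def latin_square_array)

lemma isomorph_comp:
  assumes p: "p permutes {1..N}" and q: "q permutes {1..N}"
  shows "isomorph N p (isomorph N q L) = isomorph N (p \<circ> q) L"
proof -
  have "inv (p \<circ> q) = inv q \<circ> inv p"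
    using p q by (simp add: o_inv_distrib permutes_bij)
  then show ?thesis
    using permutes_in_image[OF permutes_inv[OF p]]
    unfolding isomorph_def by (intro array_cong) simp
qed

lemma latin_square_isomorph:
  assumes L: "latin_square N L" and p: "p permutes {1..N}"
  shows "latin_square N (isomorph N p L)"
  unfolding isomorph_def latin_square_array_iff
proof (intro conjI ballI)
  have p1: "bij_betw p {1..N} {1..N}" and p2: "bij_betw (inv p) {1..N} {1..N}"
    using p permutes_imp_bij permutes_inv by blast+
  fix i assume "i \<in> {1..N}"
  then have i: "inv p i \<in> {1..N}" using bij_betwE[OF p2] by blast
  show "bij_betw (\<lambda>j. p (L (inv p i) (inv p j))) {1..N} {1..N}"
    using bij_betw_trans[OF bij_betw_trans[OF p2 latin_square_row[OF L i]] p1] by (simp add: o_def)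
  show "bij_betw (\<lambda>j. p (L (inv p j) (inv p i))) {1..N} {1..N}"
    using bij_betw_trans[OF bij_betw_trans[OF p2 latin_square_col[OF L i]] p1] by (simp add: o_def)
qed

lemma reduced_isomorph:
  assumes L: "reduced_latin_square N L" and p: "p permutes {n+1..N}" and "1 \<le> n"
  shows "reduced_latin_square N (isomorph N p L)"
proof -
  have p': "p permutes {1..N}" using p by (rule permutes_subset) auto
  have [simp]: "inv p (Suc 0) = Suc 0"
    using permutes_not_in[OF permutes_inv[OF p]] \<open>1 \<le> n\<close> by simp
  show ?thesis
    using L latin_square_isomorph[OF _ p'] permutes_in_image[OF permutes_inv[OF p']]
    by (auto simp: reduced_latin_square_def isomorph_def permutes_inverses[OF p])
qed

text \<open>\<open>p\<close> fixes the indices up to \<open>n\<close> and maps entries above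
  \<open>n\<close> to entries above \<open>n\<close>, so a corner entry that violates closure still
  does so at the same place.\<close>

lemma isomorph_notin_subsquare:
  assumes p: "p permutes {n+1..N}" and L: "latin_square N L" and "n \<le> N"
    and nonsub: "L \<notin> squares_with_subsquare N n" "reduced_latin_square N L"
  shows "isomorph N p L \<notin> squares_with_subsquare N n"
proof -
  from nonsub obtain i j where ij: "i \<in> {1..n}" "j \<in> {1..n}" "L i j \<notin> {1..n}"
    unfolding squares_with_subsquare_def by blast
  have inN: "i \<in> {1..N}" "j \<in> {1..N}" using ij \<open>n \<le> N\<close> by auto
  then have "L i j \<in> {n+1..N}" using ij(3) latin_square_range[OF L] by fastforce
  then have "p (L i j) \<in> {n+1..N}" using permutes_in_image[OF p] by blast
  moreover have "inv p i = i" "inv p j = j"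
    using ij permutes_not_in[OF permutes_inv[OF p]] by auto
  ultimately have "isomorph N p L i j \<notin> {1..n}"
    using inN by (simp add: isomorph_def)
  then show ?thesis using ij(1,2) unfolding squares_with_subsquare_def by blast
qed

text \<open>The fixed points of \<open>p\<close> form a subloop containing \<open>{1..n}\<close>. As
  \<open>{1..n}\<close> itself is not closed, there are at least \<open>n + 1\<close> of them. If
  \<open>p\<close> moved a point, the subloop would be proper, which forces
  \<open>2 * (n + 1) \<le> N\<close>, just beyond the assumed bound.\<close>

lemma automorphism_trivial:
  assumes p: "p permutes {n+1..N}" and L: "reduced_latin_square N L"
    and nonsub: "L \<notin> squares_with_subsquare N n"
    and "n \<le> N" "N \<le> 2 * n + 1"
    and fixed: "isomorph N p L = L"
  shows "p = id"
proof (rule ccontr)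
  assume "p \<noteq> id"
  have lat: "latin_square N L" using L by (simp add: reduced_latin_square_def)
  have p': "p permutes {1..N}" using p by (rule permutes_subset) auto
  define F where "F = {i \<in> {1..N}. p i = i}"
  from \<open>p \<noteq> id\<close> obtain k where "p k \<noteq> k" by (auto simp: fun_eq_iff)
  then have "k \<in> {1..N} - F" using permutes_not_in[OF p'] by (auto simp: F_def)
  moreover have "F \<subseteq> {1..N}" unfolding F_def by blast
  ultimately have "F \<subset> {1..N}" by blast
  have closed: "L i j \<in> F" if "i \<in> F" "j \<in> F" for i j
  proof -
    have ij: "i \<in> {1..N}" "j \<in> {1..N}" "inv p i = i" "inv p j = j"
      using that by (simp_all add: F_def permutes_inv_eq[OF p])
    have "L i j = isomorph N p L i j" using fixed by simp
    also have "\<dots> = p (L i j)" using ij by (simp add: isomorph_def)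
    finally have "p (L i j) = L i j" by (rule sym)
    then show ?thesis using latin_square_range[OF lat ij(1,2)] by (simp add: F_def)
  qed
  have sub: "{1..n} \<subseteq> F" using permutes_not_in[OF p] \<open>n \<le> N\<close> by (auto simp: F_def)
  from nonsub L obtain i j where "i \<in> {1..n}" "j \<in> {1..n}" "L i j \<notin> {1..n}"
    unfolding squares_with_subsquare_def by blast
  with closed sub have "{1..n} \<subset> F" by blast
  then have "n < card F"
    using psubset_card_mono[of F "{1..n}"] by (simp add: F_def)
  moreover have "2 * card F \<le> N"
    using subsquare_card_le_half[OF lat \<open>F \<subset> {1..N}\<close> closed] .
  ultimately show False using \<open>N \<le> 2 * n + 1\<close> by simp
qed

lemma fact_dvd_card_squares_without_subsquare:
  assumes "1 \<le> n" "n \<le> N" "N \<le> 2 * n + 1"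
  shows "fact (N - n) dvd card ({L. reduced_latin_square N L} - squares_with_subsquare N n)"
    (is "_ dvd card ?S")
proof -
  let ?G = "{p. p permutes {n+1..N}}"
  have big: "p permutes {1..N}" if "p \<in> ?G" for p
    using that permutes_subset[of p "{n+1..N}" "{1..N}"] by auto
  have lat: "latin_square N L" if "L \<in> ?S" for L
    using that by (simp add: reduced_latin_square_def)
  have inv_iso: "isomorph N (inv p) (isomorph N p L) = L" if "p \<in> ?G" "L \<in> ?S" for p L
    using isomorph_comp[OF permutes_inv[OF big[OF that(1)]] big[OF that(1)]]
      isomorph_id[OF lat[OF that(2)]] permutes_inv_o(2)[OF big[OF that(1)]] by simp
  have "card ?G dvd card ?S"
  proof (rule card_dvd_card_if_free_action[where act = "isomorph N"])
    show "finite ?S" using finite_reduced_latin_squares by blast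
    show "isomorph N p L \<in> ?S" if "p \<in> ?G" "L \<in> ?S" for p L
      using that reduced_isomorph[of N L p n] isomorph_notin_subsquare[OF _ lat[OF that(2)]] assms
      by simp
    show "\<exists>p\<in>?G. isomorph N p L = L" if "L \<in> ?S" for L
      using isomorph_id[OF lat[OF that]] permutes_id by blast
    show "\<exists>q\<in>?G. isomorph N q (isomorph N p L) = L" if "p \<in> ?G" "L \<in> ?S" for p L
      using inv_iso[OF that] that permutes_inv by blast
    show "\<exists>k\<in>?G. isomorph N p (isomorph N q L) = isomorph N k L"
      if "p \<in> ?G" "q \<in> ?G" "L \<in> ?S" for p q L
      using isomorph_comp[OF big[OF that(1)] big[OF that(2)]] that permutes_compose by blast
    show "inj_on (\<lambda>p. isomorph N p L) ?G" if L: "L \<in> ?S" for L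
    proof (rule inj_onI)
      fix p q assume pq: "p \<in> ?G" "q \<in> ?G" and eq: "isomorph N p L = isomorph N q L"
      \<comment> \<open>If \<open>p\<close> and \<open>q\<close> send \<open>L\<close> to the same
        square, then \<open>inv q \<circ> p\<close> is an automorphism of \<open>L\<close>, hence
        trivial.\<close>
      have "isomorph N (inv q \<circ> p) L = isomorph N (inv q) (isomorph N p L)"
        using isomorph_comp[OF permutes_inv[OF big[OF pq(2)]] big[OF pq(1)]] by simp
      also have "\<dots> = L" using eq inv_iso[OF pq(2) L] by simp
      finally have "inv q \<circ> p = id"
        using L pq assms
        by (intro automorphism_trivial[of _ n N L]) (auto intro: permutes_compose permutes_inv)
      then have "q \<circ> (inv q \<circ> p) = q" by simp
      then show "p = q" using pq(2) by (simp add: o_assoc permutes_inv_o)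
    qed
  qed
  then show ?thesis by (simp add: card_permutations)
qed

subsection \<open>Squares with a subsquare\<close>

text \<open>A bijection of \<open>{1..N}\<close> that maps \<open>{1..n}\<close> into itself
  permutes both \<open>{1..n}\<close> and its complement. Hence the upper right and lower left
  blocks contain only symbols above \<open>n\<close>.\<close>

lemma subsquare_blocks:
  assumes "L \<in> squares_with_subsquare N n" "n \<le> N"
  shows "i \<in> {1..n} \<Longrightarrow> bij_betw (L i) {1..n} {1..n}"
    and "j \<in> {1..n} \<Longrightarrow> bij_betw (\<lambda>i. L i j) {1..n} {1..n}"
    and "i \<in> {1..n} \<Longrightarrow> bij_betw (L i) {n+1..N} {n+1..N}"
    and "j \<in> {1..n} \<Longrightarrow> bij_betw (\<lambda>i. L i j) {n+1..N} {n+1..N}"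
proof -
  have L: "latin_square N L" and sub: "\<And>i j. i \<in> {1..n} \<Longrightarrow> j \<in> {1..n} \<Longrightarrow> L i j \<in> {1..n}"
    using assms by (auto simp: squares_with_subsquare_def reduced_latin_square_def)
  have split: "bij_betw f {1..n} {1..n} \<and> bij_betw f {n+1..N} {n+1..N}"
    if bij: "bij_betw f {1..N} {1..N}" and "\<And>j. j \<in> {1..n} \<Longrightarrow> f j \<in> {1..n}" for f
  proof -
    have "inj_on f {1..n}"
      using bij \<open>n \<le> N\<close> by (auto simp: bij_betw_def intro: inj_on_subset)
    moreover from this have "f ` {1..n} = {1..n}"
      using that(2) by (intro endo_inj_surj) auto
    ultimately have 1: "bij_betw f {1..n} {1..n}" by (simp add: bij_betw_def)
    moreover have "{n+1..N} = {1..N} - {1..n}" using \<open>n \<le> N\<close> by auto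
    ultimately show ?thesis
      using bij_betw_DiffI[OF bij 1] \<open>n \<le> N\<close> by simp
  qed
  have inN: "i \<in> {1..N}" if "i \<in> {1..n}" for i using that \<open>n \<le> N\<close> by simp
  show "bij_betw (L i) {1..n} {1..n}" "bij_betw (L i) {n+1..N} {n+1..N}" if "i \<in> {1..n}" for i
    using split[OF latin_square_row[OF L inN[OF that]]] sub that by auto
  show "bij_betw (\<lambda>i. L i j) {1..n} {1..n}" "bij_betw (\<lambda>i. L i j) {n+1..N} {n+1..N}"
    if "j \<in> {1..n}" for j
    using split[OF latin_square_col[OF L inN[OF that]]] sub that by auto
qed

section \<open>Independent changes of three blocks\<close>

text \<open>\<open>A\<close> overwrites the corner, \<open>t\<close> permutes rows of the upper
  right block and \<open>s\<close> renames symbols in the lower right block. The lower left block is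
  kept. Later \<open>t\<close> ranges over permutations of \<open>{2..n}\<close> only, so that the
  first row stays in order.\<close>

definition block_change ::
  "nat \<Rightarrow> nat \<Rightarrow> (nat \<Rightarrow> nat \<Rightarrow> nat) \<times> (nat \<Rightarrow> nat) \<times> (nat \<Rightarrow> nat) \<Rightarrow>
     (nat \<Rightarrow> nat \<Rightarrow> nat) \<Rightarrow> nat \<Rightarrow> nat \<Rightarrow> nat" where
  "block_change N n = (\<lambda>(A, s, t) L. array N (\<lambda>i j.
     if j \<le> n then (if i \<le> n then A i j else L i j)
     else (if i \<le> n then L (t i) j else s (L i j))))"

lemma block_change_in_squares_with_subsquare:
  assumes L: "L \<in> squares_with_subsquare N n" and n: "1 \<le> n" "n \<le> N"
    and A: "reduced_latin_square n A" and s: "s permutes {1..n}" and t: "t permutes {2..n}"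
  shows "block_change N n (A, s, t) L \<in> squares_with_subsquare N n"
proof -
  have red: "reduced_latin_square N L" and lat: "latin_square N L"
    using L by (auto simp: squares_with_subsquare_def reduced_latin_square_def)
  have latA: "latin_square n A" using A by (simp add: reduced_latin_square_def)
  note blocks = subsquare_blocks[OF L n(2)]
  have union: "{1..n} \<union> {n+1..N} = {1..N}" using n by auto
  have s_big: "s x = x" if "x > n" for x using permutes_not_in[OF s] that by simp
  have t_big: "t x = x" if "x > n" for x using permutes_not_in[OF t] that by simp
  have t_n: "t permutes {1..n}" using t by (rule permutes_subset) auto
  have t_N: "t permutes {1..N}" using t_n by (rule permutes_subset) (use n in auto)
  have s_N: "s permutes {1..N}" using s by (rule permutes_subset) (use n in auto)
  have t1: "t 1 = 1" using permutes_not_in[OF t] by simp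
  have t_in: "t i \<in> {1..n}" if "i \<in> {1..n}" for i using permutes_in_image[OF t_n] that by blast
  let ?f = "\<lambda>i j. if j \<le> n then (if i \<le> n then A i j else L i j)
     else (if i \<le> n then L (t i) j else s (L i j))"
  have "latin_square N (array N ?f)" unfolding latin_square_array_iff
  proof (intro conjI ballI)
    fix i assume i: "i \<in> {1..N}"
    show "bij_betw (?f i) {1..N} {1..N}"
    proof (cases "i \<le> n")
      case True
      then have i': "i \<in> {1..n}" using i by simp
      have "bij_betw (?f i) {1..n} {1..n}"
        using latin_square_row[OF latA i'] by (rule iffD1[OF bij_betw_cong, rotated]) (use True in auto)
      moreover have "bij_betw (?f i) {n+1..N} {n+1..N}"
        using blocks(3)[OF t_in[OF i']] by (rule iffD1[OF bij_betw_cong, rotated]) (use True in auto)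
      ultimately show ?thesis unfolding union[symmetric] by (rule bij_betw_combine) auto
    next
      case False
      \<comment> \<open>The lower left entries exceed \<open>n\<close> and are fixed by
        \<open>s\<close>, so the new row is the whole old row followed by \<open>s\<close>.\<close>
      have "s (L i j) = L i j" if "j \<in> {1..n}" for j
        using bij_betwE[OF blocks(4)[OF that], rule_format, of i] i False by (intro s_big) simp
      then have eq: "(s \<circ> L i) j = ?f i j" if "j \<in> {1..N}" for j using that False by auto
      have "bij_betw (s \<circ> L i) {1..N} {1..N}"
        using bij_betw_trans[OF latin_square_row[OF lat i] permutes_imp_bij[OF s_N]] .
      then show ?thesis by (rule iffD1[OF bij_betw_cong, rotated]) (rule eq)
    qed
  next
    fix j assume j: "j \<in> {1..N}"
    show "bij_betw (\<lambda>i. ?f i j) {1..N} {1..N}"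
    proof (cases "j \<le> n")
      case True
      then have j': "j \<in> {1..n}" using j by simp
      have "bij_betw (\<lambda>i. ?f i j) {1..n} {1..n}"
        using latin_square_col[OF latA j'] by (rule iffD1[OF bij_betw_cong, rotated]) (use True in auto)
      moreover have "bij_betw (\<lambda>i. ?f i j) {n+1..N} {n+1..N}"
        using blocks(4)[OF j'] by (rule iffD1[OF bij_betw_cong, rotated]) (use True in auto)
      ultimately show ?thesis unfolding union[symmetric] by (rule bij_betw_combine) auto
    next
      case False
      \<comment> \<open>Here \<open>s\<close> fixes the upper right entries and \<open>t\<close>
        fixes the rows below \<open>n\<close>, so the new column is the old one with
        \<open>t\<close> applied before and \<open>s\<close> after.\<close>
      have "s (L (t i) j) = L (t i) j" if "i \<in> {1..n}" for i
        using bij_betwE[OF blocks(3)[OF t_in[OF that]], rule_format, of j] j False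
        by (intro s_big) simp
      then have eq: "(s \<circ> ((\<lambda>i. L i j) \<circ> t)) i = ?f i j" if "i \<in> {1..N}" for i
        using that False t_big by auto
      have "bij_betw (s \<circ> ((\<lambda>i. L i j) \<circ> t)) {1..N} {1..N}"
        using bij_betw_trans[OF bij_betw_trans[OF permutes_imp_bij[OF t_N]
            latin_square_col[OF lat j]] permutes_imp_bij[OF s_N]] .
      then show ?thesis by (rule iffD1[OF bij_betw_cong, rotated]) (rule eq)
    qed
  qed
  then show ?thesis
    using A red n t1 latin_square_range[OF latA]
    by (auto simp: squares_with_subsquare_def block_change_def reduced_latin_square_def)
qed

lemma array_in_reduced_if_subsquare:
  assumes "L \<in> squares_with_subsquare N n" "n \<le> N"
  shows "reduced_latin_square n (array n L)"
  using assms subsquare_blocks[OF assms]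
  by (auto simp: reduced_latin_square_def latin_square_array_iff squares_with_subsquare_def)

text \<open>The outer corner overwrites the inner one, so \<open>B\<close> disappears. The
  permutations of rows compose in reverse order because they act on indices.\<close>

lemma block_change_comp:
  assumes "t permutes {2..n}" "n \<le> N"
  shows "block_change N n (A, s, t) (block_change N n (B, s', t') L) =
    block_change N n (A, s \<circ> s', t' \<circ> t) L"
proof -
  have "t permutes {1..n}" using assms(1) by (rule permutes_subset) auto
  then have "t i \<in> {1..n}" if "i \<in> {1..n}" for i using permutes_in_image that by metis
  then show ?thesis
    using \<open>n \<le> N\<close> unfolding block_change_def prod.case by (intro array_cong) fastforce
qed

text \<open>This is the identity that depends on the point: the corner is replaced by
  itself.\<close>

lemma block_change_array_id:
  assumes "L \<in> squares_with_subsquare N n"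
  shows "block_change N n (array n L, id, id) L = L"
proof -
  have "block_change N n (array n L, id, id) L = array N L"
    unfolding block_change_def prod.case by (intro array_cong) auto
  then show ?thesis
    using assms latin_square_array by (simp add: squares_with_subsquare_def reduced_latin_square_def)
qed

text \<open>\<open>A\<close> is read off the corner, and \<open>s\<close> and \<open>t\<close> off
  the last column, which lies outside the corner as \<open>n < N\<close>. Its upper entries are
  distinct and determine \<open>t\<close>. Its lower entries include all symbols up to
  \<open>n\<close> and determine \<open>s\<close>.\<close>

lemma block_change_inject:
  assumes L: "L \<in> squares_with_subsquare N n" and n: "1 \<le> n" "n < N"
    and A: "latin_square n A" "latin_square n A'"
    and s: "s permutes {1..n}" "s' permutes {1..n}"
    and t: "t permutes {2..n}" "t' permutes {2..n}"
    and eq: "block_change N n (A, s, t) L = block_change N n (A', s', t') L"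
  shows "A = A' \<and> s = s' \<and> t = t'"
proof (intro conjI)
  have lat: "latin_square N L"
    using L by (auto simp: squares_with_subsquare_def reduced_latin_square_def)
  have N: "N \<in> {1..N}" "N > n" using n by auto
  have colN: "bij_betw (\<lambda>i. L i N) {1..N} {1..N}" using latin_square_col[OF lat N(1)] .
  have eq': "block_change N n (A, s, t) L i j = block_change N n (A', s', t') L i j" for i j
    using eq by simp
  have "A i j = A' i j" if "i \<in> {1..n}" "j \<in> {1..n}" for i j
    using eq'[of i j] that n by (simp add: block_change_def)
  then have "array n A = array n A'" by (rule array_cong)
  then show "A = A'" using A by (simp add: latin_square_array)
  show "s = s'"
  proof
    fix x
    show "s x = s' x"
    proof (cases "x \<in> {1..n}")
      case True
      then have "x \<in> (\<lambda>i. L i N) ` {1..N}" using colN n by (simp add: bij_betw_def)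
      then obtain i where i: "i \<in> {1..N}" "L i N = x" by blast
      \<comment> \<open>In the first \<open>n\<close> rows, column \<open>N\<close> has only symbols
        above \<open>n\<close>.\<close>
      have "i > n"
      proof (rule ccontr)
        assume "\<not> i > n"
        then have "L i N \<in> {n+1..N}"
          using bij_betwE[OF subsquare_blocks(3)[OF L, of i]] i(1) n by simp
        then show False using i True by simp
      qed
      then show ?thesis using eq'[of i N] i N by (simp add: block_change_def)
    next
      case False
      then show ?thesis using s permutes_not_in by metis
    qed
  qed
  show "t = t'"
  proof
    fix i
    show "t i = t' i"
    proof (cases "i \<in> {2..n}")
      case True
      then have "L (t i) N = L (t' i) N"
        using eq'[of i N] N by (simp add: block_change_def)
      moreover have "t i \<in> {1..N}" "t' i \<in> {1..N}"
        using True t[THEN permutes_in_image, of i] n by auto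
      ultimately show ?thesis using colN by (auto simp: bij_betw_def dest: inj_onD)
    next
      case False
      then show ?thesis using t permutes_not_in by metis
    qed
  qed
qed

lemma fact_fact_num_reduced_dvd_card_squares_with_subsquare:
  assumes n: "1 \<le> n" "n < N"
  shows "fact n * fact (n - 1) * num_reduced n dvd card (squares_with_subsquare N n)"
proof -
  let ?R = "{A. reduced_latin_square n A}" and ?S = "squares_with_subsquare N n"
  let ?G = "?R \<times> {s. s permutes {1..n}} \<times> {t. t permutes {2..n}}"
  have "card ?G dvd card ?S"
  proof (rule card_dvd_card_if_free_action[where act = "block_change N n"])
    show "finite ?S"
      by (rule finite_subset[OF _ finite_reduced_latin_squares[of N]])
        (auto simp: squares_with_subsquare_def)
    show "block_change N n g L \<in> ?S" if "g \<in> ?G" "L \<in> ?S" for g L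
      using that n block_change_in_squares_with_subsquare by auto
    have R: "array n L \<in> ?R" if "L \<in> ?S" for L
      using array_in_reduced_if_subsquare that n by simp
    show "\<exists>g\<in>?G. block_change N n g L = L" if "L \<in> ?S" for L
      using block_change_array_id[OF that] R[OF that] permutes_id
      by (intro bexI[of _ "(array n L, id, id)"]) auto
    show "\<exists>h\<in>?G. block_change N n h (block_change N n g L) = L" if "g \<in> ?G" "L \<in> ?S" for g L
    proof -
      from that(1) obtain A s t where g: "g = (A, s, t)" "s permutes {1..n}" "t permutes {2..n}"
        by auto
      \<comment> \<open>To undo the change, the original corner of \<open>L\<close> is written back;
        \<open>A\<close> itself has no inverse.\<close>
      have "block_change N n (array n L, inv s, inv t) (block_change N n g L) = L"
        using block_change_comp[OF permutes_inv[OF g(3)]] block_change_array_id[OF that(2)] g n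
        by (simp add: permutes_inv_o)
      then show ?thesis using R[OF that(2)] permutes_inv g
        by (intro bexI[of _ "(array n L, inv s, inv t)"]) auto
    qed
    show "\<exists>k\<in>?G. block_change N n g (block_change N n h L) = block_change N n k L"
      if "g \<in> ?G" "h \<in> ?G" "L \<in> ?S" for g h L
    proof -
      obtain A s t B s' t' where gh: "g = (A, s, t)" "h = (B, s', t')" by (metis prod_cases3)
      then show ?thesis
        using that n by (intro bexI[of _ "(A, s \<circ> s', t' \<circ> t)"])
          (auto simp: block_change_comp intro: permutes_compose)
    qed
    show "inj_on (\<lambda>g. block_change N n g L) ?G" if "L \<in> ?S" for L
    proof (rule inj_onI)
      fix g h assume "g \<in> ?G" "h \<in> ?G" "block_change N n g L = block_change N n h L"
      moreover obtain A s t B s' t' where "g = (A, s, t)" "h = (B, s', t')" by (metis prod_cases3)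
      ultimately show "g = h"
        using block_change_inject[OF that n, of A B s s' t t'] by (simp add: reduced_latin_square_def)
    qed
  qed
  \<comment> \<open>The factor \<open>fact (n - 1)\<close> counts the permutations of
    \<open>{2..n}\<close>.\<close>
  moreover have "card ?G = num_reduced n * (fact n * fact (n - 1))"
    by (simp add: card_cartesian_product card_permutations num_reduced_def)
  ultimately show ?thesis by (simp add: mult.commute)
qed

section \<open>Adding the two counts\<close>

lemma num_reduced_split:
  "num_reduced N = card (squares_with_subsquare N n) +
     card ({L. reduced_latin_square N L} - squares_with_subsquare N n)"
proof -
  have "squares_with_subsquare N n \<subseteq> {L. reduced_latin_square N L}"
    by (auto simp: squares_with_subsquare_def)
  then show ?thesis
    unfolding num_reduced_def
    by (metis card_Diff_subset card_mono finite_reduced_latin_squares finite_subset le_add_diff_inverse)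
qed

theorem theorem2:
  fixes n :: nat
  assumes "n \<ge> 1"
  shows "gcd (fact n * fact (n - 1) * num_reduced n) (fact (n + 1)) dvd num_reduced (2 * n + 1)
       \<and> fact n dvd num_reduced (2 * n)"
proof
  \<comment> \<open>The first argument of the gcd divides the number of squares with a subsquare,
    the second the number of those without, so the gcd divides both summands.\<close>
  show "gcd (fact n * fact (n - 1) * num_reduced n) (fact (n + 1)) dvd num_reduced (2 * n + 1)"
    unfolding num_reduced_split[of "2 * n + 1" n]
  proof (rule dvd_add)
    show "gcd (fact n * fact (n - 1) * num_reduced n) (fact (n + 1))
        dvd card (squares_with_subsquare (2 * n + 1) n)"
      using fact_fact_num_reduced_dvd_card_squares_with_subsquare[of n "2 * n + 1"] assms
      by (intro dvd_trans[OF gcd_dvd1]) simp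
    have "2 * n + 1 - n = n + 1" by simp
    then show "gcd (fact n * fact (n - 1) * num_reduced n) (fact (n + 1))
        dvd card ({L. reduced_latin_square (2 * n + 1) L} - squares_with_subsquare (2 * n + 1) n)"
      using fact_dvd_card_squares_without_subsquare[of n "2 * n + 1"] assms
      by (intro dvd_trans[OF gcd_dvd2]) simp
  qed
  \<comment> \<open>For even order \<open>N - n\<close> is \<open>n\<close>, and
    \<open>fact n\<close> is also a factor of the divisor found for the squares with a
    subsquare.\<close>
  show "fact n dvd num_reduced (2 * n)"
    unfolding num_reduced_split[of "2 * n" n]
  proof (rule dvd_add)
    have "fact n * fact (n - 1) * num_reduced n dvd card (squares_with_subsquare (2 * n) n)"
      using fact_fact_num_reduced_dvd_card_squares_with_subsquare assms by simp
    then show "fact n dvd card (squares_with_subsquare (2 * n) n)"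
      by (blast dest: dvd_mult_left)
    show "fact n dvd card ({L. reduced_latin_square (2 * n) L} - squares_with_subsquare (2 * n) n)"
      using fact_dvd_card_squares_without_subsquare[of n "2 * n"] assms by simp
  qed
qed

end
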